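(* Let $\mathbf{L}\in\mathbb{R}^{n\times n}$ be an invertible lower triangular matrix (the incomplete Cholesky factor, $\mathbf{A}\approx\mathbf{L}\mathbf{L}^\top$, of a symmetric positive definite matrix $\mathbf{A}$), let $\varepsilon^{\mathrm S}\le\varepsilon^{\mathrm R}$ be unit roundoffs, and let $\mathbf{f}\in\mathbb{R}^n$. Let $\mathbf{w}$ and $\hat{\mathbf{w}}$ be the approximations computed by applying the incomplete Cholesky smoother (described in the context) to the vector $\mathbf{f}$ in exact arithmetic (without rounding the matrix $\mathbf{L}$ to a lower precision) and in finite precision, respectively. Let $$\underline{m}_{L,\varepsilon^{\mathrm S}}=\frac{\underline{m}_L}{1-\underline{m}_L\varepsilon^{\mathrm S}},\qquad \eta_L=\varepsilon^{\mathrm R}+\varepsilon^{\mathrm S}\underline{m}_{L,\varepsilon^{\mathrm S}}+\varepsilon^{\mathrm R}\varepsilon^{\mathrm S}\underline{m}_{L,\varepsilon^{\mathrm S}}.$$ Assuming $\underline{m}_L\varepsilon^{\mathrm S}<1$ and $\eta_L\underline{\kappa}_L<1/2$, the Euclidean norm of the finite precision error $\delta_{\mathrm{IC}}=\mathbf{w}-\hat{\mathbf{w}}$ can be bounded as $$\|\delta_{\mathrm{IC}}\|\le\Lambda_{\mathrm{IC}}\|\mathbf{f}\|,\qquad \Lambda_{\mathrm{IC}}=\Big(2\big(\varepsilon^{\mathrm R}+\varepsilon^{\mathrm S}(\underline{m}_{L,\varepsilon^{\mathrm S}}+1/2)\big)\underline{\kappa}_L+R\Big)\|\mathbf{L}^{-1}\|^2,$$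 where the remainder $R$ contains higher order terms, i.e., terms which involve $(\varepsilon^{\mathrm S})^2$, $(\varepsilon^{\mathrm R})^2$, or $\varepsilon^{\mathrm S}\varepsilon^{\mathrm R}$.
   Context: $\|\cdot\|$ is the Euclidean vector norm and induced (spectral) matrix norm; $|\mathbf{K}|$ is the matrix of entrywise absolute values; $\underline{\kappa}_L=\|\mathbf{L}^{-1}\|\,\||\mathbf{L}|\|$; $\underline{m}_L$ is the maximum number of nonzero entries in a row or a column of $\mathbf{L}$. **Rounding model.** Finite precision arithmetic with unit roundoff $\varepsilon$ follows the standard model: for numbers $a,b$ in the arithmetic and $\mathrm{op}\in\{+,-,\times,/\}$, the computed result is $(a\ \mathrm{op}\ b)(1+\delta)$ with $|\delta|\le\varepsilon$, with no breakdown due to overflow or underflow. Rounding a vector $\mathbf{v}$ to $\varepsilon$-precision gives $\mathbf{v}+\delta$ with $\|\delta\|\le\varepsilon\|\mathbf{v}\|$; rounding a matrix $\mathbf{K}$ gives $\mathbf{K}+\Delta\mathbf{K}$ with $|\Delta\mathbf{K}|\le\varepsilon|\mathbf{K}|$ entrywise. **Incomplete Cholesky smoother with zero initial approximation.** The matrix $\mathbf{L}$ is stored in memory in a precision with unit roundoff $\varepsilon^{\mathrm R}$ (errors from computing the factor $\mathbf{L}$ itself are not considered), and the triangular solves are computed in the same or higher precision with unit roundoff $\varepsilon^{\mathrm S}\le\varepsilon^{\mathrm R}$. Given $\mathbf{f}$: (1) round $\mathbf{f}$ to $\varepsilon^{\mathrm S}$-precision; (2) compute $\mathbf{v}$ by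 solving $\mathbf{L}\mathbf{v}=\mathbf{f}$ via substitution in $\varepsilon^{\mathrm S}$-precision; (3) compute $\mathbf{w}$ by solving $\mathbf{L}^\top\mathbf{w}=\mathbf{v}$ via substitution in $\varepsilon^{\mathrm S}$-precision; return $\mathbf{w}$. In finite precision the substitutions use the matrix $\mathbf{L}$ rounded to $\varepsilon^{\mathrm R}$-precision. In exact arithmetic the result is $\mathbf{w}=\mathbf{L}^{-\top}\mathbf{L}^{-1}\mathbf{f}$. **Substitution.** For a triangular matrix $\mathbf{T}=(t_{i,j})$ and right-hand side $\mathbf{b}$, the entries of the solution are computed successively (forward if lower triangular, backward if upper triangular) by $x_i=\big(b_i-\sum_{j\ne i,\,t_{i,j}\ne0}t_{i,j}x_j\big)/t_{i,i}$, using only the nonzero entries of the matrix. *)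

theory Defs
  imports "HOL-Analysis.Analysis" "HOL-Library.Multiset"
begin

subsection \<open>Rounding\<close>

text \<open>
  The standard model is stated relationally: \<open>fl \<epsilon> x y\<close> says that \<open>y\<close> is an admissible computed value
  of an elementary operation whose exact result is \<open>x\<close>. A statement about all computed results then
  covers every arithmetic satisfying the model.
\<close>

definition fl :: "real \<Rightarrow> real \<Rightarrow> real \<Rightarrow> bool" where
  "fl \<epsilon> x y \<longleftrightarrow> (\<exists>\<delta>. \<bar>\<delta>\<bar> \<le> \<epsilon> \<and> y = x * (1 + \<delta>))"

definition rounded_vec :: "real \<Rightarrow> real^'n \<Rightarrow> real^'n \<Rightarrow> bool" where
  "rounded_vec \<epsilon> v v' \<longleftrightarrow> norm (v' - v) \<le> \<epsilon> * norm v"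

text \<open>On \<^typ>\<open>real^'n^'m\<close> the absolute value and the order are entrywise.\<close>

definition rounded_mat :: "real \<Rightarrow> real^'n^'m \<Rightarrow> real^'n^'m \<Rightarrow> bool" where
  "rounded_mat \<epsilon> K K' \<longleftrightarrow> \<bar>K' - K\<bar> \<le> \<epsilon> *\<^sub>R \<bar>K\<bar>"

text \<open>
  \<open>fl_sum \<epsilon> A s\<close>: adding up the numbers in \<open>A\<close>, in some order and with some bracketing, can produce \<open>s\<close>.
  A single summand involves no operation and hence no rounding.
\<close>

inductive fl_sum :: "real \<Rightarrow> real multiset \<Rightarrow> real \<Rightarrow> bool" for \<epsilon> where
  single: "fl_sum \<epsilon> {#x#} x"
| plus: "fl_sum \<epsilon> A a \<Longrightarrow> fl_sum \<epsilon> B b \<Longrightarrow> fl \<epsilon> (a + b) s \<Longrightarrow> fl_sum \<epsilon> (A + B) s"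


subsection \<open>Substitution\<close>

definition lower_triangular :: "real^'n::{finite,wellorder}^'n::{finite,wellorder} \<Rightarrow> bool" where
  "lower_triangular T \<longleftrightarrow> (\<forall>i j. i < j \<longrightarrow> T $ i $ j = 0)"

text \<open>
  \<open>x\<close> is a possible result of solving \<open>T x = b\<close> by substitution, for \<open>T\<close> lower or upper triangular. The
  entry \<open>x $ i\<close> depends only on the entries \<open>x $ j\<close> with \<open>T $ i $ j \<noteq> 0\<close>, so triangularity of \<open>T\<close>
  determines the order (forward or backward) in which the entries are computed. The products \<open>p j\<close> are
  rounded, then the numerator is accumulated in any order, then the quotient is rounded. Since
  negation is exact and the model is symmetric under it, subtracting the products is written as
  adding their negatives.
\<close>

definition fl_substitution :: "real \<Rightarrow> real^'n^'n \<Rightarrow> real^'n \<Rightarrow> real^'n \<Rightarrow> bool" where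
  "fl_substitution \<epsilon> T b x \<longleftrightarrow>
     (\<forall>i. let J = {j. j \<noteq> i \<and> T $ i $ j \<noteq> 0} in
        \<exists>p s. (\<forall>j\<in>J. fl \<epsilon> (T $ i $ j * x $ j) (p j)) \<and>
              fl_sum \<epsilon> ({# b $ i #} + image_mset (\<lambda>j. - p j) (mset_set J)) s \<and>
              fl \<epsilon> (s / T $ i $ i) (x $ i))"


subsection \<open>Incomplete Cholesky smoother\<close>

definition ic_exact :: "real^'n^'n \<Rightarrow> real^'n \<Rightarrow> real^'n" where
  "ic_exact L f = matrix_inv (transpose L) *v (matrix_inv L *v f)"

definition ic_computed :: "real \<Rightarrow> real \<Rightarrow> real^'n^'n \<Rightarrow> real^'n \<Rightarrow> real^'n \<Rightarrow> bool" where
  "ic_computed \<epsilon>S \<epsilon>R L f w \<longleftrightarrow>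
     (\<exists>L' f' v. rounded_mat \<epsilon>R L L' \<and> rounded_vec \<epsilon>S f f' \<and>
        fl_substitution \<epsilon>S L' f' v \<and> fl_substitution \<epsilon>S (transpose L') v w)"


subsection \<open>Quantities in the error bound\<close>

definition spectral_norm :: "real^'n^'m \<Rightarrow> real" where
  "spectral_norm A = onorm ((*v) A)"

definition kappa :: "real^'n^'n \<Rightarrow> real" where
  "kappa L = spectral_norm (matrix_inv L) * spectral_norm \<bar>L\<bar>"

definition max_nnz :: "real^'n^'m \<Rightarrow> nat" where
  "max_nnz L = max (MAX i. card {j. L $ i $ j \<noteq> 0}) (MAX j. card {i. L $ i $ j \<noteq> 0})"

definition m_eps :: "nat \<Rightarrow> real \<Rightarrow> real" where
  "m_eps m \<epsilon> = real m / (1 - real m * \<epsilon>)"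

definition eta :: "nat \<Rightarrow> real \<Rightarrow> real \<Rightarrow> real" where
  "eta m \<epsilon>S \<epsilon>R = \<epsilon>R + \<epsilon>S * m_eps m \<epsilon>S + \<epsilon>R * \<epsilon>S * m_eps m \<epsilon>S"

definition admissible_roundoffs :: "nat \<Rightarrow> real \<Rightarrow> (real \<times> real) set" where
  "admissible_roundoffs m \<kappa> =
     {(\<epsilon>S, \<epsilon>R). 0 < \<epsilon>S \<and> \<epsilon>S \<le> \<epsilon>R \<and> real m * \<epsilon>S < 1 \<and> eta m \<epsilon>S \<epsilon>R * \<kappa> < 1/2}"

text \<open>
  \<open>R\<close> consists of terms involving \<open>\<epsilon>S\<^sup>2\<close>, \<open>\<epsilon>R\<^sup>2\<close> or \<open>\<epsilon>S \<epsilon>R\<close>. The coefficients may depend on the roundoffs (as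
  \<^const>\<open>m_eps\<close> does) but have to stay bounded on \<open>D\<close>: otherwise every function would qualify.
\<close>

definition higher_order_on :: "(real \<times> real) set \<Rightarrow> (real \<Rightarrow> real \<Rightarrow> real) \<Rightarrow> bool" where
  "higher_order_on D R \<longleftrightarrow>
     (\<exists>a b c :: real \<times> real \<Rightarrow> real. bounded (a ` D) \<and> bounded (b ` D) \<and> bounded (c ` D) \<and>
        (\<forall>(\<epsilon>S, \<epsilon>R)\<in>D. R \<epsilon>S \<epsilon>R =
            a (\<epsilon>S, \<epsilon>R) * \<epsilon>S\<^sup>2 + b (\<epsilon>S, \<epsilon>R) * \<epsilon>R\<^sup>2 + c (\<epsilon>S, \<epsilon>R) * (\<epsilon>S * \<epsilon>R)))"

end

theory Submission
  imports Defs
begin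

text \<open>
  The first step is a residual form of the backward error analysis of substitution. If \<open>x\<close> is
  computed from \<open>T x = b\<close> with unit roundoff \<open>\<epsilon>\<close>, then every row satisfies
  \<open>\<bar>b - T x\<bar> \<le> \<gamma> \<bar>T\<bar> \<bar>x\<bar>\<close> with \<open>\<gamma> = \<epsilon> m / (1 - \<epsilon> m)\<close>, where \<open>m\<close> bounds the number of nonzero
  entries per row. The bound is relative to \<open>\<bar>T\<bar> \<bar>x\<bar>\<close> alone, without a term in \<open>b\<close>: of the roundings
  that hit \<open>b\<close> during the accumulation, those shared with a product are common factors, and the
  others are divided out and charged to the products. This works for every order and bracketing of
  the summation (\<open>fl_sum_pivot_error\<close>), and a row with \<open>k\<close> nonzero entries collects at most \<open>k\<close>
  factors \<open>1 + \<delta>\<close> or \<open>1 / (1 + \<delta>)\<close> per term (\<open>fl_substitution_row_error\<close>).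

  Replacing \<open>T\<close> by a factor \<open>L\<close> of which \<open>T\<close> is a rounding turns \<open>\<gamma>\<close> into \<open>\<eta> = \<epsilon>R + \<gamma> + \<epsilon>R \<gamma>\<close>.
  Multiplying the residual by the inverse gives
  \<open>\<parallel>L\<inverse> b - x\<parallel> \<le> \<eta> \<kappa> \<parallel>x\<parallel>\<close> (\<open>rounded_solve_error\<close>); transposition changes neither \<open>\<kappa>\<close> nor \<open>m\<close>,
  so the same holds for the second solve.

  With \<open>t = \<eta> \<kappa> < 1/2\<close>, each computed solution is at most \<open>1 / (1 - t)\<close> times as long as the exact
  solution for the same right-hand side. Composing the rounding of \<open>f\<close> and the two solves,
  \<open>\<parallel>w - w'\<parallel> \<le> (\<epsilon>S + t (1 + \<epsilon>S) (1 / (1 - t) + 1 / (1 - t)\<^sup>2)) \<parallel>L\<inverse>\<parallel>\<^sup>2 \<parallel>f\<parallel>\<close>.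
  To first order the bracket is \<open>\<epsilon>S + 2 t\<close>, and \<open>\<epsilon>S \<le> \<epsilon>S \<kappa>\<close> because \<open>\<kappa> \<ge> 1\<close>; this is the leading term of
  the bound. What is left is an explicit expression of second order in the roundoffs. Its
  coefficients are bounded because \<open>\<eta> \<kappa> < 1/2\<close> and \<open>\<kappa> \<ge> 1\<close> force \<open>\<epsilon>R < 1/2\<close> and \<open>m \<epsilon>S \<le> 1/3\<close>, which
  keeps \<open>m / (1 - m \<epsilon>S)\<close> away from its pole.
\<close>

section \<open>Rounding errors of sums\<close>

lemma inverse_one_plus_close:
  fixes \<delta> \<epsilon> :: real
  assumes "\<bar>\<delta>\<bar> \<le> \<epsilon>" "\<epsilon> < 1"
  shows "\<bar>1 / (1 + \<delta>) - 1\<bar> \<le> 1 / (1 - \<epsilon>) - 1"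
proof -
  have pos: "1 + \<delta> > 0" "1 - \<epsilon> > 0" using assms by auto
  have eq: "1 / (1 + \<delta>) - 1 = - \<delta> / (1 + \<delta>)" "1 / (1 - \<epsilon>) - 1 = \<epsilon> / (1 - \<epsilon>)"
    using pos by (auto simp: field_simps)
  have "\<bar>- \<delta> / (1 + \<delta>)\<bar> = \<bar>\<delta>\<bar> / (1 + \<delta>)" using pos by (simp add: abs_divide)
  also have "\<dots> \<le> \<epsilon> / (1 - \<epsilon>)"
    by (rule frac_le) (use assms pos in auto)
  finally show ?thesis unfolding eq .
qed

lemma unit_roundoff_le_gamma1:
  fixes \<epsilon> :: real
  assumes "0 \<le> \<epsilon>" "\<epsilon> < 1"
  shows "\<epsilon> \<le> 1 / (1 - \<epsilon>) - 1"
proof -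
  have "\<epsilon> * (1 - \<epsilon>) \<le> \<epsilon>" using assms by (simp add: mult_left_le)
  with assms show ?thesis by (simp add: field_simps)
qed

text \<open>
  The rule by which relative errors accumulate. With \<open>c = 1 / (1 - \<epsilon>)\<close>, both \<open>1 + \<delta>\<close> and \<open>1 / (1 + \<delta>)\<close>
  differ from \<open>1\<close> by at most \<open>c - 1\<close>, so \<open>n\<close> such factors in any mixture amount to an error of at
  most \<open>c ^ n - 1\<close>. Combining \<open>m\<close> factors with \<open>k\<close> factors then simply adds exponents.
\<close>

lemma perturb_mult:
  fixes c F y z S :: real
  assumes F: "\<bar>F - 1\<bar> \<le> c ^ m - 1" and y: "\<bar>y - z\<bar> \<le> (c ^ k - 1) * S" and z: "\<bar>z\<bar> \<le> S"
  shows "\<bar>F * y - z\<bar> \<le> (c ^ (m + k) - 1) * S"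
proof -
  have Fm: "\<bar>F\<bar> \<le> c ^ m" using F by linarith
  have cm: "0 \<le> c ^ m - 1" using F by linarith
  have "F * y - z = F * (y - z) + (F - 1) * z" by algebra
  hence "\<bar>F * y - z\<bar> \<le> \<bar>F\<bar> * \<bar>y - z\<bar> + \<bar>F - 1\<bar> * \<bar>z\<bar>"
    by (metis abs_mult abs_triangle_ineq)
  also have "\<dots> \<le> c ^ m * ((c ^ k - 1) * S) + (c ^ m - 1) * S"
    by (intro add_mono mult_mono Fm y F z cm) (use cm in auto)
  also have "\<dots> = (c ^ (m + k) - 1) * S" by (simp add: algebra_simps power_add)
  finally show ?thesis .
qed

lemma abs_sum_mset_le:
  fixes A :: "real multiset"
  shows "\<bar>\<Sum>\<^sub># A\<bar> \<le> (\<Sum>x\<in>#A. \<bar>x\<bar>)"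
  by (induction A) auto

lemma sum_mset_abs_nonneg:
  fixes A :: "real multiset"
  shows "0 \<le> (\<Sum>x\<in>#A. \<bar>x\<bar>)"
  using abs_sum_mset_le[of A] by linarith

lemma fl_sum_nonempty: "fl_sum \<epsilon> A s \<Longrightarrow> A \<noteq> {#}"
  by (induction rule: fl_sum.induct) auto

text \<open>
  However \<open>n\<close> numbers are bracketed, they are joined by \<open>n - 1\<close> additions, and a summand passes
  through each of them at most once.
\<close>

lemma fl_sum_error:
  assumes "fl_sum \<epsilon> A s" "0 \<le> \<epsilon>" "\<epsilon> < 1"
  shows "\<bar>s - \<Sum>\<^sub># A\<bar> \<le> ((1 / (1 - \<epsilon>)) ^ (size A - 1) - 1) * (\<Sum>x\<in>#A. \<bar>x\<bar>)"
  using assms(1)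
proof (induction rule: fl_sum.induct)
  case (single x)
  show ?case by simp
next
  case (plus A a B b s)
  define c where "c = 1 / (1 - \<epsilon>)"
  have c: "1 \<le> c" using assms by (simp add: c_def)
  let ?S = "\<lambda>A. \<Sum>x\<in>#A. \<bar>x\<bar>"
  let ?k = "size A - 1 + (size B - 1)"
  obtain \<delta> where d: "\<bar>\<delta>\<bar> \<le> \<epsilon>" "s = (a + b) * (1 + \<delta>)"
    using plus.hyps by (auto simp: fl_def)
  have "\<bar>(1 + \<delta>) - 1\<bar> \<le> c ^ 1 - 1"
    using d unit_roundoff_le_gamma1[OF assms(2,3)] by (simp add: c_def)
  moreover have "\<bar>(a + b) - (\<Sum>\<^sub># A + \<Sum>\<^sub># B)\<bar> \<le> (c ^ ?k - 1) * (?S A + ?S B)"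
  proof -
    have "\<bar>(a + b) - (\<Sum>\<^sub># A + \<Sum>\<^sub># B)\<bar> \<le> \<bar>a - \<Sum>\<^sub># A\<bar> + \<bar>b - \<Sum>\<^sub># B\<bar>" by linarith
    also have "\<dots> \<le> (c ^ (size A - 1) - 1) * ?S A + (c ^ (size B - 1) - 1) * ?S B"
      using plus.IH unfolding c_def by linarith
    also have "\<dots> \<le> (c ^ ?k - 1) * ?S A + (c ^ ?k - 1) * ?S B"
      by (intro add_mono mult_right_mono diff_mono power_increasing c sum_mset_abs_nonneg) auto
    finally show ?thesis by (simp add: algebra_simps)
  qed
  moreover have "\<bar>\<Sum>\<^sub># A + \<Sum>\<^sub># B\<bar> \<le> ?S A + ?S B"
    using abs_sum_mset_le[of A] abs_sum_mset_le[of B] by linarith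
  ultimately have "\<bar>(1 + \<delta>) * (a + b) - (\<Sum>\<^sub># A + \<Sum>\<^sub># B)\<bar> \<le> (c ^ (1 + ?k) - 1) * (?S A + ?S B)"
    by (rule perturb_mult)
  moreover have "1 + ?k = size (A + B) - 1"
  proof -
    have "size A \<noteq> 0" "size B \<noteq> 0"
      using plus.hyps fl_sum_nonempty by (metis size_eq_0_iff_empty)+
    thus ?thesis unfolding size_union by linarith
  qed
  ultimately show ?case
    by (simp only: d(2) mult.commute[of "1 + \<delta>"] c_def sum_mset.union image_mset_union)
qed

text \<open>
  Here the error is moved away from one distinguished summand \<open>b\<close>, which is to appear exactly. The
  factor \<open>F\<close> is the reciprocal of the product of all roundings on the path from \<open>b\<close> to the root of
  the summation tree; multiplying \<open>s\<close> by it restores \<open>b\<close>. The other summands then carry the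
  roundings between them and that path together with the reciprocals of those between \<open>b\<close> and the
  point where they join, and all other roundings on the path cancel.
\<close>

lemma fl_sum_pivot_error:
  assumes "fl_sum \<epsilon> (add_mset b A) s" and \<epsilon>: "0 \<le> \<epsilon>" "\<epsilon> < 1"
  shows "\<exists>F. \<bar>F - 1\<bar> \<le> (1 / (1 - \<epsilon>)) ^ size A - 1 \<and>
             \<bar>F * s - b - \<Sum>\<^sub># A\<bar> \<le> ((1 / (1 - \<epsilon>)) ^ size A - 1) * (\<Sum>x\<in>#A. \<bar>x\<bar>)"
  using assms(1)
proof (induction "add_mset b A" s arbitrary: b A rule: fl_sum.induct)
  case (single x)
  thus ?case by (auto intro!: exI[of _ 1])
next
  case (plus P p Q q s)
  define c where "c = 1 / (1 - \<epsilon>)"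
  have c: "1 \<le> c" using \<epsilon> by (simp add: c_def)
  let ?S = "\<lambda>A. \<Sum>x\<in>#A. \<bar>x\<bar>"
  obtain \<delta> where d: "\<bar>\<delta>\<bar> \<le> \<epsilon>" "s = (p + q) * (1 + \<delta>)"
    using plus.hyps by (auto simp: fl_def)
  have d0: "1 + \<delta> \<noteq> 0" using d \<epsilon> by auto
  \<comment> \<open>Addition is commutative, so only one case needs work: \<open>u\<close> is the operand that contains \<open>b\<close>,
    and \<open>v\<close> is summed from other numbers only.\<close>
  have key: "\<exists>F. \<bar>F - 1\<bar> \<le> c ^ size A - 1 \<and> \<bar>F * s - b - \<Sum>\<^sub># A\<bar> \<le> (c ^ size A - 1) * ?S A"
    if s: "s = (u + v) * (1 + \<delta>)" and A: "A = U + V"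
      and V: "fl_sum \<epsilon> V v"
      and IH: "\<exists>F. \<bar>F - 1\<bar> \<le> c ^ size U - 1 \<and> \<bar>F * u - b - \<Sum>\<^sub># U\<bar> \<le> (c ^ size U - 1) * ?S U"
    for u v U V
  proof -
    obtain F where F: "\<bar>F - 1\<bar> \<le> c ^ size U - 1"
        "\<bar>F * u - b - \<Sum>\<^sub># U\<bar> \<le> (c ^ size U - 1) * ?S U"
      using IH by blast
    have szV: "size V - 1 + 1 = size V"
      using V fl_sum_nonempty by (metis Suc_eq_plus1 Suc_pred' nonempty_has_size)
    \<comment> \<open>The path from \<open>b\<close> gets one more rounding. There is room for it because \<open>V\<close> is not empty.\<close>
    have G: "\<bar>1 / (1 + \<delta>) * F - 1\<bar> \<le> c ^ (1 + size U) - 1"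
      using perturb_mult[of "1 / (1 + \<delta>)" c 1 F 1 "size U" 1]
        inverse_one_plus_close[OF d(1) \<epsilon>(2)] F(1) by (simp add: c_def)
    have G': "\<bar>1 / (1 + \<delta>) * F - 1\<bar> \<le> c ^ size A - 1"
    proof -
      have "c ^ (1 + size U) \<le> c ^ size A"
        by (rule power_increasing[OF _ c]) (use A szV in auto)
      with G show ?thesis by linarith
    qed
    \<comment> \<open>The new rounding cancels against its reciprocal, so \<open>v\<close> is multiplied by the old \<open>F\<close> alone.\<close>
    have "\<bar>F * v - \<Sum>\<^sub># V\<bar> \<le> (c ^ (size U + (size V - 1)) - 1) * ?S V"
      using perturb_mult[OF F(1) _ abs_sum_mset_le] fl_sum_error[OF V \<epsilon>] by (simp add: c_def)
    also have "\<dots> \<le> (c ^ size A - 1) * ?S V"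
      by (intro mult_right_mono diff_mono power_increasing c sum_mset_abs_nonneg) (auto simp: A)
    finally have Fv: "\<bar>F * v - \<Sum>\<^sub># V\<bar> \<le> (c ^ size A - 1) * ?S V" .
    have "(c ^ size U - 1) * ?S U \<le> (c ^ size A - 1) * ?S U"
      by (intro mult_right_mono diff_mono power_increasing c sum_mset_abs_nonneg) (auto simp: A)
    with F(2) Fv have "\<bar>F * u + F * v - b - \<Sum>\<^sub># A\<bar> \<le> (c ^ size A - 1) * ?S U + (c ^ size A - 1) * ?S V"
      by (simp add: A)
    moreover have "1 / (1 + \<delta>) * F * s = F * u + F * v"
      using d0 by (simp add: s field_simps)
    ultimately have "\<bar>1 / (1 + \<delta>) * F * s - b - \<Sum>\<^sub># A\<bar> \<le> (c ^ size A - 1) * ?S A"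
      by (simp add: A algebra_simps)
    with G' show ?thesis by blast
  qed
  have "b \<in># P + Q" by (metis plus.hyps(6) union_single_eq_member)
  hence "b \<in># P \<or> b \<in># Q" by auto
  thus ?case
  proof
    assume "b \<in># P"
    then obtain U where U: "P = add_mset b U" by (metis insert_DiffM)
    hence "A = U + Q" using plus.hyps(6) by simp
    from key[OF d(2) this plus.hyps(3)] plus.hyps(2)[OF U] show ?case by (simp add: c_def)
  next
    assume "b \<in># Q"
    then obtain U where U: "Q = add_mset b U" by (metis insert_DiffM)
    hence "A = U + P" using plus.hyps(6) by (simp add: add.commute)
    from key[OF _ this plus.hyps(1), of q] d(2) plus.hyps(4)[OF U] show ?case
      by (simp add: c_def add.commute)
  qed
qed

section \<open>Residual of a computed triangular solve\<close>

text \<open>Bernoulli's inequality converts the multiplicative error bound into the one with \<^const>\<open>m_eps\<close>.\<close>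

lemma gamma_le:
  fixes \<epsilon> :: real
  assumes "0 \<le> \<epsilon>" "real m * \<epsilon> < 1" "k \<le> m" "\<epsilon> < 1"
  shows "(1 / (1 - \<epsilon>)) ^ k - 1 \<le> \<epsilon> * m_eps m \<epsilon>"
proof -
  have "(1 / (1 - \<epsilon>)) ^ k \<le> (1 / (1 - \<epsilon>)) ^ m"
    using assms by (intro power_increasing) auto
  also have "\<dots> = 1 / (1 - \<epsilon>) ^ m" by (simp add: power_divide)
  also have "\<dots> \<le> 1 / (1 - m * \<epsilon>)"
    using Bernoulli_inequality[of "-\<epsilon>" m] assms by (intro frac_le) auto
  also have "\<dots> = 1 + \<epsilon> * m_eps m \<epsilon>" using assms by (simp add: m_eps_def field_simps)
  finally show ?thesis by linarith
qed

text \<open>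
  Let the row have \<open>n\<close> nonzero entries off the diagonal. Apply the previous section with \<open>b $ i\<close> as the
  exact summand: the accumulation contributes \<open>n\<close> factors, to the products as well as to the
  numerator \<open>s\<close>. A product has one further rounding of its own, and \<open>s\<close> differs from the diagonal
  term \<open>T $ i $ i * x $ i\<close> by the rounding of the quotient. Hence every term carries at most \<open>n + 1\<close>
  factors, which is the number of nonzero entries of the row.
\<close>

lemma fl_substitution_row_error:
  fixes T :: "real^'n^'n"
  assumes sub: "fl_substitution \<epsilon> T b x" and \<epsilon>: "0 \<le> \<epsilon>" "\<epsilon> < 1" and Tii: "T $ i $ i \<noteq> 0"
  shows "\<bar>(b - T *v x) $ i\<bar> \<le> ((1 / (1 - \<epsilon>)) ^ card {j. T $ i $ j \<noteq> 0} - 1) * (\<bar>T\<bar> *v \<bar>x\<bar>) $ i"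
proof -
  define c where "c = 1 / (1 - \<epsilon>)"
  have c: "1 \<le> c" using \<epsilon> by (simp add: c_def)
  define J where "J = {j. j \<noteq> i \<and> T $ i $ j \<noteq> 0}"
  have fin: "finite J" by simp
  define n where "n = card J"
  have card: "card {j. T $ i $ j \<noteq> 0} = n + 1"
  proof -
    have "{j. T $ i $ j \<noteq> 0} = insert i J" using Tii by (auto simp: J_def)
    thus ?thesis by (simp add: n_def J_def)
  qed
  obtain p s where p: "\<And>j. j \<in> J \<Longrightarrow> fl \<epsilon> (T $ i $ j * x $ j) (p j)"
    and s: "fl_sum \<epsilon> ({# b $ i #} + image_mset (\<lambda>j. - p j) (mset_set J)) s"
    and q: "fl \<epsilon> (s / T $ i $ i) (x $ i)"
    using sub unfolding fl_substitution_def J_def Let_def by meson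
  let ?A = "image_mset (\<lambda>j. - p j) (mset_set J)"
  let ?X = "\<Sum>j\<in>J. \<bar>T $ i $ j * x $ j\<bar>"
  have size: "size ?A = n" by (simp add: n_def)
  have "\<Sum>\<^sub># ?A = (\<Sum>j\<in>J. - p j)" "(\<Sum>y\<in>#?A. \<bar>y\<bar>) = (\<Sum>j\<in>J. \<bar>p j\<bar>)"
    by (simp_all add: sum_unfold_sum_mset multiset.map_comp comp_def)
  hence sums: "\<Sum>\<^sub># ?A = - (\<Sum>j\<in>J. p j)" "(\<Sum>y\<in>#?A. \<bar>y\<bar>) = (\<Sum>j\<in>J. \<bar>p j\<bar>)"
    by (simp_all only: sum_negf)
  obtain F where F: "\<bar>F - 1\<bar> \<le> c ^ n - 1"
    and Fs: "\<bar>F * s - b $ i + (\<Sum>j\<in>J. p j)\<bar> \<le> (c ^ n - 1) * (\<Sum>j\<in>J. \<bar>p j\<bar>)"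
    using fl_sum_pivot_error[of \<epsilon> "b $ i" ?A s] s \<epsilon> unfolding size sums c_def by auto
  obtain \<delta> where d: "\<bar>\<delta>\<bar> \<le> \<epsilon>" "x $ i = s / T $ i $ i * (1 + \<delta>)"
    using q by (auto simp: fl_def)
  have d0: "1 + \<delta> \<noteq> 0" using d \<epsilon> by auto
  have Fs_eq: "F * s = F * (1 / (1 + \<delta>)) * (T $ i $ i * x $ i)"
    using d(2) d0 Tii by (simp add: field_simps)
  have diag: "\<bar>F * (1 / (1 + \<delta>)) * (T $ i $ i * x $ i) - T $ i $ i * x $ i\<bar>
      \<le> (c ^ (n + 1) - 1) * \<bar>T $ i $ i * x $ i\<bar>"
  proof -
    have "\<bar>F * (1 / (1 + \<delta>)) - 1\<bar> \<le> (c ^ (n + 1) - 1) * 1"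
      by (rule perturb_mult[OF F])
         (use inverse_one_plus_close[OF d(1) \<epsilon>(2)] in \<open>auto simp: c_def\<close>)
    hence "\<bar>F * (1 / (1 + \<delta>)) - 1\<bar> * \<bar>T $ i $ i * x $ i\<bar> \<le> (c ^ (n + 1) - 1) * \<bar>T $ i $ i * x $ i\<bar>"
      by (intro mult_right_mono) auto
    thus ?thesis by (simp only: abs_mult[symmetric] left_diff_distrib mult_1_left)
  qed
  have p_err: "\<bar>p j - T $ i $ j * x $ j\<bar> \<le> (c - 1) * \<bar>T $ i $ j * x $ j\<bar>" if "j \<in> J" for j
  proof -
    obtain e where e: "\<bar>e\<bar> \<le> \<epsilon>" "p j = T $ i $ j * x $ j * (1 + e)"
      using p[OF \<open>j \<in> J\<close>] by (auto simp: fl_def)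
    have "\<bar>p j - T $ i $ j * x $ j\<bar> = \<bar>e\<bar> * \<bar>T $ i $ j * x $ j\<bar>"
      unfolding e(2) abs_mult[symmetric] by (simp add: algebra_simps)
    also have "\<dots> \<le> (c - 1) * \<bar>T $ i $ j * x $ j\<bar>"
      using e unit_roundoff_le_gamma1[OF \<epsilon>] by (intro mult_right_mono) (auto simp: c_def)
    finally show ?thesis .
  qed
  have "\<bar>p j\<bar> \<le> c * \<bar>T $ i $ j * x $ j\<bar>" if "j \<in> J" for j
    using p_err[OF that] by (simp add: left_diff_distrib)
  hence p_abs: "(\<Sum>j\<in>J. \<bar>p j\<bar>) \<le> c * ?X"
    unfolding sum_distrib_left by (rule sum_mono)
  have "\<bar>(\<Sum>j\<in>J. p j) - (\<Sum>j\<in>J. T $ i $ j * x $ j)\<bar> \<le> (\<Sum>j\<in>J. \<bar>p j - T $ i $ j * x $ j\<bar>)"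
    unfolding sum_subtractf[symmetric] by (rule sum_abs)
  also have "\<dots> \<le> (c - 1) * ?X"
    unfolding sum_distrib_left by (rule sum_mono) (rule p_err)
  finally have p_sum: "\<bar>(\<Sum>j\<in>J. p j) - (\<Sum>j\<in>J. T $ i $ j * x $ j)\<bar> \<le> (c - 1) * ?X" .
  have offdiag: "(c ^ n - 1) * (\<Sum>j\<in>J. \<bar>p j\<bar>) + (c - 1) * ?X \<le> (c ^ (n + 1) - 1) * ?X"
  proof -
    have "(c ^ n - 1) * (\<Sum>j\<in>J. \<bar>p j\<bar>) \<le> (c ^ n - 1) * (c * ?X)"
      using p_abs c by (intro mult_left_mono) auto
    thus ?thesis by (simp add: algebra_simps)
  qed
  have split_sum: "(\<Sum>j\<in>UNIV. g j) = g i + (\<Sum>j\<in>J. g j)"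
    if "\<And>j. T $ i $ j = 0 \<Longrightarrow> g j = 0" for g :: "'n \<Rightarrow> real"
  proof -
    have "(\<Sum>j\<in>UNIV. g j) = (\<Sum>j\<in>insert i J. g j)"
      by (rule sum.mono_neutral_right) (use that in \<open>auto simp: J_def\<close>)
    thus ?thesis by (simp add: J_def)
  qed
  have "(b - T *v x) $ i = b $ i - T $ i $ i * x $ i - (\<Sum>j\<in>J. T $ i $ j * x $ j)"
    using split_sum[of "\<lambda>j. T $ i $ j * x $ j"] by (simp add: matrix_vector_mult_def)
  also have "\<bar>\<dots>\<bar> \<le> (c ^ (n + 1) - 1) * \<bar>T $ i $ i * x $ i\<bar> + (c ^ (n + 1) - 1) * ?X"
    using diag Fs p_sum offdiag unfolding Fs_eq by linarith
  also have "\<dots> = (c ^ (n + 1) - 1) * (\<bar>T\<bar> *v \<bar>x\<bar>) $ i"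
    using split_sum[of "\<lambda>j. \<bar>T $ i $ j * x $ j\<bar>"]
    by (simp add: matrix_vector_mult_def abs_vec_def abs_mult distrib_left)
  finally show ?thesis by (simp only: card c_def)
qed

section \<open>Spectral norms\<close>

lemma spectral_norm_nonneg: "0 \<le> spectral_norm (A :: real^'n^'m)"
  unfolding spectral_norm_def by (rule onorm_pos_le) simp

lemma norm_matrix_vector_le: "norm (A *v x) \<le> spectral_norm A * norm (x :: real^'n)"
  unfolding spectral_norm_def by (rule onorm) simp

text \<open>
  From \<open>\<parallel>z\<parallel>\<^sup>2 = y \<bullet> A z\<close> for \<open>z = A\<^sup>T y\<close> and the Cauchy-Schwarz inequality, dividing by \<open>\<parallel>z\<parallel>\<close>.
\<close>

lemma spectral_norm_transpose_le: "spectral_norm (transpose A) \<le> spectral_norm (A :: real^'n^'m)"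
  unfolding spectral_norm_def
proof (rule onorm_bound)
  show "0 \<le> onorm ((*v) A)" by (rule onorm_pos_le) simp
  fix y :: "real^'m"
  let ?z = "transpose A *v y"
  have "norm ?z * norm ?z = inner y (A *v ?z)"
    by (simp add: dot_lmul_matrix[symmetric] power2_norm_eq_inner[symmetric] power2_eq_square)
  also have "\<dots> \<le> norm y * norm (A *v ?z)" by (rule norm_cauchy_schwarz)
  also have "\<dots> \<le> norm y * (onorm ((*v) A) * norm ?z)"
    by (intro mult_left_mono onorm) auto
  finally have "norm ?z * norm ?z \<le> (onorm ((*v) A) * norm y) * norm ?z" by (simp add: ac_simps)
  thus "norm ?z \<le> onorm ((*v) A) * norm y"
    by (cases "norm ?z = 0") (auto simp: onorm_pos_le)
qed

lemma spectral_norm_transpose: "spectral_norm (transpose A) = spectral_norm (A :: real^'n^'m)"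
  using spectral_norm_transpose_le[of A] spectral_norm_transpose_le[of "transpose A"]
  by (simp add: transpose_transpose)

lemma norm_abs_vec: "norm \<bar>x :: real^'n\<bar> = norm x"
  by (simp add: norm_vec_def abs_vec_def)

lemma abs_matrix_vector_le: "\<bar>(A *v x) $ i\<bar> \<le> (\<bar>A\<bar> *v \<bar>x :: real^'n\<bar>) $ i"
  unfolding matrix_vector_mult_def abs_vec_def
  by (simp add: sum_abs abs_mult[symmetric])

lemma norm_le_of_abs_matrix_bound:
  fixes A :: "real^'n^'m"
  assumes "\<And>i. \<bar>y $ i\<bar> \<le> c * (\<bar>A\<bar> *v \<bar>x\<bar>) $ i"
  shows "norm y \<le> \<bar>c\<bar> * spectral_norm \<bar>A\<bar> * norm x"
proof -
  have "norm y \<le> norm (c *\<^sub>R (\<bar>A\<bar> *v \<bar>x\<bar>))"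
    by (rule norm_le_componentwise_cart) (use assms in \<open>auto intro: order_trans[OF _ abs_ge_self]\<close>)
  also have "\<dots> \<le> \<bar>c\<bar> * (spectral_norm \<bar>A\<bar> * norm x)"
    using norm_matrix_vector_le[of "\<bar>A\<bar>" "\<bar>x\<bar>"] by (simp add: norm_abs_vec mult_left_mono)
  finally show ?thesis by simp
qed

lemma matrix_inv_left_right:
  fixes A :: "real^'n^'n"
  assumes "invertible A"
  shows "A ** matrix_inv A = mat 1" "matrix_inv A ** A = mat 1"
  using someI_ex[OF assms[unfolded invertible_def]] unfolding matrix_inv_def by auto

lemma matrix_inv_transpose:
  fixes A :: "real^'n^'n"
  assumes "invertible A"
  shows "matrix_inv (transpose A) = transpose (matrix_inv A)"
proof -
  have "transpose A ** transpose (matrix_inv A) = mat 1"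
    using matrix_inv_left_right(2)[OF assms] by (metis matrix_transpose_mul transpose_mat)
  moreover have "matrix_inv (transpose A) ** transpose A = mat 1"
    using matrix_inv_left_right(2)[OF transpose_invertible[OF assms]] .
  ultimately show ?thesis by (metis matrix_mul_assoc matrix_mul_lid matrix_mul_rid)
qed

lemma kappa_ge_1:
  fixes L :: "real^'n^'n"
  assumes "invertible L"
  shows "1 \<le> kappa L"
proof -
  let ?e = "axis undefined 1 :: real^'n"
  have "?e = matrix_inv L *v (L *v ?e)"
    by (simp add: matrix_vector_mul_assoc matrix_inv_left_right[OF assms])
  hence "norm ?e \<le> spectral_norm (matrix_inv L) * norm (L *v ?e)"
    by (metis norm_matrix_vector_le)
  also have "norm (L *v ?e) \<le> \<bar>1\<bar> * spectral_norm \<bar>L\<bar> * norm ?e"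
    by (rule norm_le_of_abs_matrix_bound) (simp only: mult_1_left abs_matrix_vector_le)
  finally show ?thesis
    by (simp add: kappa_def spectral_norm_nonneg mult_left_mono)
qed

section \<open>One solve with a rounded triangular factor\<close>

lemma card_row_le_max_nnz: "card {j. L $ i $ j \<noteq> 0} \<le> max_nnz (L :: real^'n^'m)"
  unfolding max_nnz_def by (intro max.coboundedI1 Max_ge) auto

lemma card_col_le_max_nnz: "card {i. L $ i $ j \<noteq> 0} \<le> max_nnz (L :: real^'n^'m)"
  unfolding max_nnz_def by (intro max.coboundedI2 Max_ge) auto

lemma max_nnz_transpose: "max_nnz (transpose L) = max_nnz (L :: real^'n^'m)"
  by (simp add: max_nnz_def transpose_def max.commute)

lemma kappa_transpose:
  fixes L :: "real^'n^'n"
  assumes "invertible L"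
  shows "kappa (transpose L) = kappa L"
proof -
  have "\<bar>transpose L\<bar> = transpose \<bar>L\<bar>" by (simp add: transpose_def abs_vec_def vec_eq_iff)
  thus ?thesis by (simp add: kappa_def matrix_inv_transpose[OF assms] spectral_norm_transpose)
qed

lemma rounded_mat_entry:
  "rounded_mat \<epsilon> K K' \<Longrightarrow> \<bar>K' $ i $ j - K $ i $ j\<bar> \<le> \<epsilon> * \<bar>K $ i $ j\<bar>"
  by (simp add: rounded_mat_def less_eq_vec_def abs_vec_def)

lemma rounded_mat_transpose: "rounded_mat \<epsilon> K K' \<Longrightarrow> rounded_mat \<epsilon> (transpose K) (transpose K')"
  by (simp add: rounded_mat_def less_eq_vec_def abs_vec_def transpose_def)

lemma lower_triangular_diag_nonzero:
  fixes L :: "real^'n::{finite,wellorder}^'n::{finite,wellorder}"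
  assumes "invertible L" "lower_triangular L"
  shows "L $ i $ i \<noteq> 0"
proof -
  have "det L = (\<Prod>i\<in>UNIV. L $ i $ i)"
    by (rule det_lowerdiagonal) (use assms in \<open>auto simp: lower_triangular_def\<close>)
  with assms(1) show ?thesis by (simp add: invertible_det_nz)
qed

text \<open>
  The solve uses the rounded factor \<open>L'\<close>, but the error is measured against \<open>L\<close>. The residual of \<open>x\<close>
  for \<open>L\<close> is the residual for \<open>L'\<close>, at most \<open>\<gamma> \<bar>L'\<bar> \<bar>x\<bar> \<le> \<gamma> (1 + \<epsilon>R) \<bar>L\<bar> \<bar>x\<bar>\<close>, plus \<open>(L' - L) x\<close>, at
  most \<open>\<epsilon>R \<bar>L\<bar> \<bar>x\<bar>\<close>; the coefficients add up to \<^const>\<open>eta\<close>. Rounding is relative, so it creates no new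
  nonzero entries and, as \<open>\<epsilon>R < 1\<close>, leaves the diagonal nonzero. Bounding by \<open>\<parallel>x\<parallel>\<close>, the computed
  solution, rather than by \<open>\<parallel>b\<parallel>\<close> keeps a single factor \<open>\<parallel>L\<inverse>\<parallel>\<close>, the one absorbed in \<^const>\<open>kappa\<close>.
\<close>

lemma rounded_solve_error:
  fixes L :: "real^'n^'n"
  assumes inv: "invertible L" and diag: "\<And>i. L $ i $ i \<noteq> 0"
    and L': "rounded_mat \<epsilon>R L L'" and sub: "fl_substitution \<epsilon>S L' b x"
    and \<epsilon>: "0 \<le> \<epsilon>S" "\<epsilon>S < 1" "0 \<le> \<epsilon>R" "\<epsilon>R < 1" and m: "real (max_nnz L) * \<epsilon>S < 1"
  shows "norm (matrix_inv L *v b - x) \<le> eta (max_nnz L) \<epsilon>S \<epsilon>R * kappa L * norm x"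
proof -
  define g where "g = \<epsilon>S * m_eps (max_nnz L) \<epsilon>S"
  have g: "0 \<le> g" using \<epsilon> m by (simp add: g_def m_eps_def)
  have eta: "eta (max_nnz L) \<epsilon>S \<epsilon>R = g * (1 + \<epsilon>R) + \<epsilon>R"
    by (simp add: eta_def g_def algebra_simps)
  note ent = rounded_mat_entry[OF L']
  have row: "\<bar>(b - L *v x) $ i\<bar> \<le> eta (max_nnz L) \<epsilon>S \<epsilon>R * (\<bar>L\<bar> *v \<bar>x\<bar>) $ i" for i
  proof -
    have "L' $ i $ i \<noteq> 0"
    proof
      assume "L' $ i $ i = 0"
      hence "\<bar>L $ i $ i\<bar> \<le> \<epsilon>R * \<bar>L $ i $ i\<bar>" using ent[of i i] by simp
      with diag[of i] \<epsilon> show False by simp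
    qed
    note res = fl_substitution_row_error[OF sub \<epsilon>(1,2) this]
    have "{j. L' $ i $ j \<noteq> 0} \<subseteq> {j. L $ i $ j \<noteq> 0}"
      using ent[of i] by (auto) (metis abs_zero diff_zero mult_zero_right abs_le_zero_iff)
    hence card: "card {j. L' $ i $ j \<noteq> 0} \<le> max_nnz L"
      by (rule order_trans[OF card_mono card_row_le_max_nnz, rotated]) simp
    have absx: "(\<bar>A\<bar> *v \<bar>x\<bar>) $ i = (\<Sum>j\<in>UNIV. \<bar>A $ i $ j\<bar> * \<bar>x $ j\<bar>)" for A :: "real^'n^'n"
      by (simp add: matrix_vector_mult_def abs_vec_def)
    have "\<bar>L' $ i $ j\<bar> \<le> (1 + \<epsilon>R) * \<bar>L $ i $ j\<bar>" for j
      using ent[of i j] by (simp add: distrib_right)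
    hence L'x: "(\<bar>L'\<bar> *v \<bar>x\<bar>) $ i \<le> (1 + \<epsilon>R) * (\<bar>L\<bar> *v \<bar>x\<bar>) $ i"
      unfolding absx sum_distrib_left mult.assoc[symmetric] by (intro sum_mono mult_right_mono) auto
    have "0 \<le> (\<bar>L'\<bar> *v \<bar>x\<bar>) $ i" unfolding absx by (intro sum_nonneg) auto
    hence "((1 / (1 - \<epsilon>S)) ^ card {j. L' $ i $ j \<noteq> 0} - 1) * (\<bar>L'\<bar> *v \<bar>x\<bar>) $ i
        \<le> g * (\<bar>L'\<bar> *v \<bar>x\<bar>) $ i"
      using gamma_le[OF \<epsilon>(1) m card \<epsilon>(2)] by (intro mult_right_mono) (auto simp: g_def)
    with res have 1: "\<bar>(b - L' *v x) $ i\<bar> \<le> g * ((1 + \<epsilon>R) * (\<bar>L\<bar> *v \<bar>x\<bar>) $ i)"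
      using mult_left_mono[OF L'x g] by linarith
    have "\<bar>((L' - L) *v x) $ i\<bar> \<le> (\<bar>L' - L\<bar> *v \<bar>x\<bar>) $ i" by (rule abs_matrix_vector_le)
    also have "\<dots> \<le> \<epsilon>R * (\<bar>L\<bar> *v \<bar>x\<bar>) $ i"
      unfolding absx sum_distrib_left mult.assoc[symmetric]
      by (intro sum_mono mult_right_mono) (use ent in auto)
    finally have 2: "\<bar>(L' *v x - L *v x) $ i\<bar> \<le> \<epsilon>R * (\<bar>L\<bar> *v \<bar>x\<bar>) $ i"
      by (simp add: matrix_vector_mult_diff_rdistrib)
    have "(b - L *v x) $ i = (b - L' *v x) $ i + (L' *v x - L *v x) $ i" by simp
    with 1 2 show ?thesis unfolding eta by (simp only: distrib_right mult.assoc)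
  qed
  have eta0: "0 \<le> eta (max_nnz L) \<epsilon>S \<epsilon>R" using g \<epsilon> by (simp add: eta)
  have "matrix_inv L *v b - x = matrix_inv L *v (b - L *v x)"
    by (simp add: matrix_vector_mult_diff_distrib matrix_vector_mul_assoc matrix_inv_left_right[OF inv])
  hence "norm (matrix_inv L *v b - x) \<le> spectral_norm (matrix_inv L) * norm (b - L *v x)"
    by (metis norm_matrix_vector_le)
  also have "\<dots> \<le> spectral_norm (matrix_inv L) *
      (\<bar>eta (max_nnz L) \<epsilon>S \<epsilon>R\<bar> * spectral_norm \<bar>L\<bar> * norm x)"
    by (intro mult_left_mono norm_le_of_abs_matrix_bound row spectral_norm_nonneg)
  finally show ?thesis using eta0 by (simp add: kappa_def ac_simps)
qed

section \<open>The remainder and the error bound\<close>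

text \<open>
  The products \<open>\<epsilon>R \<epsilon>S m_eps\<close> come from \<^const>\<open>eta\<close>, the other terms from \<open>two_solves_scalar_bound\<close> below.
  For \<open>\<kappa> < 0\<close> and \<open>m > 0\<close> there are admissible roundoffs with \<open>m \<epsilon>S\<close> arbitrarily close to \<open>1\<close>, where the second
  expression would not have bounded coefficients. Condition numbers of invertible matrices are at
  least \<open>1\<close>, so the value for \<open>\<kappa> < 1\<close> is a matter of choice, and \<open>0\<close> is of higher order.
\<close>

definition ic_remainder :: "nat \<Rightarrow> real \<Rightarrow> real \<Rightarrow> real \<Rightarrow> real" where
  "ic_remainder m \<kappa> \<epsilon>S \<epsilon>R =
     (if \<kappa> < 1 then 0
      else let t = eta m \<epsilon>S \<epsilon>R * \<kappa> in
        2 * \<epsilon>R * \<epsilon>S * m_eps m \<epsilon>S * \<kappa> + 6 * \<epsilon>S * t + 8 * t\<^sup>2)"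

text \<open>
  Since \<open>\<kappa> \<ge> 1\<close>, already \<open>\<eta> < 1/2\<close>, and both summands \<open>\<epsilon>R\<close> and \<open>\<gamma> = m \<epsilon>S / (1 - m \<epsilon>S)\<close> of \<open>\<eta>\<close> are below
  \<open>1/2\<close>. The latter means \<open>m \<epsilon>S < 1/3\<close>, so the denominator is at least \<open>2/3\<close>.
\<close>

lemma admissible_bounds:
  assumes D: "(\<epsilon>S, \<epsilon>R) \<in> admissible_roundoffs m \<kappa>" and \<kappa>: "1 \<le> \<kappa>"
  shows "\<epsilon>R < 1/2" "0 \<le> m_eps m \<epsilon>S" "m_eps m \<epsilon>S \<le> 3/2 * real m"
proof -
  have eps: "0 < \<epsilon>S" "\<epsilon>S \<le> \<epsilon>R" "real m * \<epsilon>S < 1" and e: "eta m \<epsilon>S \<epsilon>R * \<kappa> < 1/2"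
    using D by (auto simp: admissible_roundoffs_def)
  show mu: "0 \<le> m_eps m \<epsilon>S" using eps by (simp add: m_eps_def)
  hence g: "0 \<le> \<epsilon>S * m_eps m \<epsilon>S" "0 \<le> \<epsilon>R * \<epsilon>S * m_eps m \<epsilon>S" using eps by auto
  hence "0 \<le> eta m \<epsilon>S \<epsilon>R" using eps by (simp add: eta_def)
  from mult_left_mono[OF \<kappa> this] e have eta: "eta m \<epsilon>S \<epsilon>R < 1/2" by simp
  with g eps show "\<epsilon>R < 1/2" unfolding eta_def by linarith
  from eta g eps have "\<epsilon>S * m_eps m \<epsilon>S < 1/2" unfolding eta_def by linarith
  hence "3 * (real m * \<epsilon>S) < 1" using eps by (simp add: m_eps_def field_simps)
  hence "real m * (3 * (real m * \<epsilon>S)) \<le> real m * 1" by (intro mult_left_mono) auto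
  hence "real m \<le> 3/2 * real m * (1 - real m * \<epsilon>S)" by (simp add: algebra_simps)
  thus "m_eps m \<epsilon>S \<le> 3/2 * real m" using eps by (simp add: m_eps_def divide_le_eq)
qed

lemma ic_remainder_higher_order:
  "higher_order_on (admissible_roundoffs m \<kappa>) (ic_remainder m \<kappa>)"
proof (cases "\<kappa> < 1")
  case True
  have bd: "bounded ((\<lambda>_. 0 :: real) ` admissible_roundoffs m \<kappa>)"
    by (rule boundedI[of _ 0]) auto
  from True show ?thesis
    unfolding higher_order_on_def
    by (intro exI[of _ "\<lambda>_. 0"] conjI bd) (auto simp: ic_remainder_def)
next
  case False
  hence \<kappa>: "1 \<le> \<kappa>" by simp
  let ?D = "admissible_roundoffs m \<kappa>"
  define M where "M = 3/2 * real m"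
  have M: "0 \<le> M" by (simp add: M_def)
  define mu where "mu = m_eps m"
  \<comment> \<open>Expand the remainder with \<open>t = \<kappa> (\<epsilon>R + \<epsilon>S mu (1 + \<epsilon>R))\<close>, leaving the factor \<open>1 + \<epsilon>R\<close> in the
    coefficients: what remains is homogeneous of degree two in the roundoffs.\<close>
  define a where "a = (\<lambda>(\<epsilon>S :: real, \<epsilon>R :: real). 6 * \<kappa> * (mu \<epsilon>S * (1 + \<epsilon>R)) + 8 * \<kappa>\<^sup>2 * (mu \<epsilon>S * (1 + \<epsilon>R))\<^sup>2)"
  define b where "b = (\<lambda>(\<epsilon>S :: real, \<epsilon>R :: real). 8 * \<kappa>\<^sup>2)"
  define c where "c = (\<lambda>(\<epsilon>S :: real, \<epsilon>R :: real). 6 * \<kappa> + 2 * \<kappa> * mu \<epsilon>S + 16 * \<kappa>\<^sup>2 * (mu \<epsilon>S * (1 + \<epsilon>R)))"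
  have bds: "0 \<le> mu \<epsilon>S" "mu \<epsilon>S \<le> M" "0 \<le> mu \<epsilon>S * (1 + \<epsilon>R)" "mu \<epsilon>S * (1 + \<epsilon>R) \<le> M * 2"
    if "(\<epsilon>S, \<epsilon>R) \<in> ?D" for \<epsilon>S \<epsilon>R
  proof -
    have "0 \<le> \<epsilon>R" using that by (auto simp: admissible_roundoffs_def)
    moreover note admissible_bounds[OF that \<kappa>]
    ultimately show "0 \<le> mu \<epsilon>S" "mu \<epsilon>S \<le> M" "0 \<le> mu \<epsilon>S * (1 + \<epsilon>R)" "mu \<epsilon>S * (1 + \<epsilon>R) \<le> M * 2"
      unfolding mu_def M_def using mult_mono[of "m_eps m \<epsilon>S" "3/2 * real m" "1 + \<epsilon>R" 2] by auto
  qed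
  have "bounded (a ` ?D)"
  proof (rule boundedI, clarify)
    fix \<epsilon>S \<epsilon>R assume "(\<epsilon>S, \<epsilon>R) \<in> ?D"
    define y where "y = mu \<epsilon>S * (1 + \<epsilon>R)"
    note * = bds[OF \<open>(\<epsilon>S, \<epsilon>R) \<in> ?D\<close>, folded y_def]
    have "y\<^sup>2 \<le> (M * 2)\<^sup>2" by (rule power_mono) (use * in auto)
    hence "6 * \<kappa> * y + 8 * \<kappa>\<^sup>2 * y\<^sup>2 \<le> 6 * \<kappa> * (M * 2) + 8 * \<kappa>\<^sup>2 * (M * 2)\<^sup>2"
      using * \<kappa> by (intro add_mono mult_left_mono) auto
    moreover have "0 \<le> 6 * \<kappa> * y + 8 * \<kappa>\<^sup>2 * y\<^sup>2"
      using * \<kappa> by (intro add_nonneg_nonneg mult_nonneg_nonneg) auto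
    ultimately show "norm (a (\<epsilon>S, \<epsilon>R)) \<le> 6 * \<kappa> * (M * 2) + 8 * \<kappa>\<^sup>2 * (M * 2)\<^sup>2"
      by (simp add: a_def y_def)
  qed
  moreover have "bounded (b ` ?D)"
    by (rule boundedI[of _ "8 * \<kappa>\<^sup>2"]) (auto simp: b_def)
  moreover have "bounded (c ` ?D)"
  proof (rule boundedI, clarify)
    fix \<epsilon>S \<epsilon>R assume "(\<epsilon>S, \<epsilon>R) \<in> ?D"
    define y where "y = mu \<epsilon>S * (1 + \<epsilon>R)"
    note * = bds[OF \<open>(\<epsilon>S, \<epsilon>R) \<in> ?D\<close>, folded y_def]
    have "6 * \<kappa> + 2 * \<kappa> * mu \<epsilon>S + 16 * \<kappa>\<^sup>2 * y \<le> 6 * \<kappa> + 2 * \<kappa> * M + 16 * \<kappa>\<^sup>2 * (M * 2)"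
      using * \<kappa> by (intro add_mono mult_left_mono) auto
    moreover have "0 \<le> 6 * \<kappa> + 2 * \<kappa> * mu \<epsilon>S + 16 * \<kappa>\<^sup>2 * y"
      using * \<kappa> by (intro add_nonneg_nonneg mult_nonneg_nonneg) auto
    ultimately show "norm (c (\<epsilon>S, \<epsilon>R)) \<le> 6 * \<kappa> + 2 * \<kappa> * M + 16 * \<kappa>\<^sup>2 * (M * 2)"
      by (simp add: c_def y_def)
  qed
  moreover have "ic_remainder m \<kappa> \<epsilon>S \<epsilon>R
      = a (\<epsilon>S, \<epsilon>R) * \<epsilon>S\<^sup>2 + b (\<epsilon>S, \<epsilon>R) * \<epsilon>R\<^sup>2 + c (\<epsilon>S, \<epsilon>R) * (\<epsilon>S * \<epsilon>R)" for \<epsilon>S \<epsilon>R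
    using False
    by (simp add: ic_remainder_def Let_def eta_def a_def b_def c_def mu_def) algebra
  ultimately show ?thesis unfolding higher_order_on_def by blast
qed

text \<open>
  With \<open>q = 1 / (1 - t) \<le> 2\<close>, the identity \<open>q = 1 + q t\<close> gives \<open>q \<le> 1 + 2 t\<close> and \<open>q\<^sup>2 \<le> 1 + 6 t\<close>, which
  leave the first-order part \<open>2 t\<close> of the left-hand side intact. In the term that already contains
  \<open>e t\<close>, the crude estimate \<open>q + q\<^sup>2 \<le> 6\<close> is enough.
\<close>

lemma two_solves_scalar_bound:
  fixes t :: real
  assumes "0 \<le> t" "t < 1/2" "0 \<le> e" "e < 1"
  shows "t * (1 + e) * (1 / (1 - t) + 1 / (1 - t)\<^sup>2) \<le> 2 * t + 6 * e * t + 8 * t\<^sup>2"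
proof -
  define q where "q = 1 / (1 - t)"
  have q0: "0 \<le> q" and q2: "q \<le> 2" and q: "q = 1 + q * t"
    using assms by (auto simp: q_def field_simps)
  have qt: "q * t \<le> 2 * t" using q2 assms by (intro mult_right_mono) auto
  have q1: "q \<le> 1 + 2 * t" using q qt by linarith
  have "q\<^sup>2 = q + q * (q * t)" using q by (metis distrib_left mult.right_neutral power2_eq_square)
  also have "q * (q * t) \<le> 2 * (2 * t)"
    by (rule mult_mono) (use q2 qt q0 assms in auto)
  finally have q2': "q\<^sup>2 \<le> 1 + 6 * t" using q1 by linarith
  have "q + q\<^sup>2 \<le> 2 + 8 * t" using q1 q2' by linarith
  hence 1: "t * (q + q\<^sup>2) \<le> t * (2 + 8 * t)" using assms by (intro mult_left_mono) auto
  have "q\<^sup>2 \<le> 2\<^sup>2" by (rule power_mono[OF q2 q0])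
  hence "q + q\<^sup>2 \<le> 6" using q2 by simp
  hence 2: "(e * t) * (q + q\<^sup>2) \<le> (e * t) * 6" using assms by (intro mult_left_mono) auto
  from 1 2 have "t * (1 + e) * (q + q\<^sup>2) \<le> 2 * t + 6 * e * t + 8 * t\<^sup>2"
    by (simp add: algebra_simps power2_eq_square)
  thus ?thesis by (simp add: q_def power_divide)
qed

text \<open>
  The error of the first solve is amplified by the exact second solve, and the second solve adds its
  own error. Both are relative to computed vectors, whose lengths are traced back to \<open>\<parallel>f\<parallel>\<close> by
  absorbing the error \<open>t \<parallel>x\<parallel>\<close> into the left-hand side of \<open>\<parallel>x\<parallel> \<le> \<parallel>y\<parallel> + t \<parallel>x\<parallel>\<close>.
\<close>

lemma ic_error_bound:
  fixes L :: "real^'n::{finite,wellorder}^'n::{finite,wellorder}"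
  assumes inv: "invertible L" and tri: "lower_triangular L"
    and \<epsilon>: "0 < \<epsilon>S" "\<epsilon>S \<le> \<epsilon>R" and m: "real (max_nnz L) * \<epsilon>S < 1"
    and eta: "eta (max_nnz L) \<epsilon>S \<epsilon>R * kappa L < 1/2"
    and comp: "ic_computed \<epsilon>S \<epsilon>R L f w'"
  shows "norm (ic_exact L f - w') \<le>
      (2 * (\<epsilon>R + \<epsilon>S * (m_eps (max_nnz L) \<epsilon>S + 1/2)) * kappa L
         + ic_remainder (max_nnz L) (kappa L) \<epsilon>S \<epsilon>R)
      * (spectral_norm (matrix_inv L))\<^sup>2 * norm f"
proof -
  define K where "K = spectral_norm (matrix_inv L)"
  define t where "t = eta (max_nnz L) \<epsilon>S \<epsilon>R * kappa L"
  have K0: "0 \<le> K" by (simp add: K_def spectral_norm_nonneg)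
  have \<kappa>: "1 \<le> kappa L" by (rule kappa_ge_1[OF inv])
  note diag = lower_triangular_diag_nonzero[OF inv tri]
  have D: "(\<epsilon>S, \<epsilon>R) \<in> admissible_roundoffs (max_nnz L) (kappa L)"
    using \<epsilon> m eta by (simp add: admissible_roundoffs_def)
  note bds = admissible_bounds[OF D \<kappa>]
  have e: "0 \<le> \<epsilon>S" "\<epsilon>S < 1" "0 \<le> \<epsilon>R" "\<epsilon>R < 1" using \<epsilon> bds by auto
  have t0: "0 \<le> t" using bds e \<kappa> by (simp add: t_def eta_def)
  have t1: "t < 1/2" using eta by (simp add: t_def)
  obtain L' f' v where L': "rounded_mat \<epsilon>R L L'" and f': "rounded_vec \<epsilon>S f f'"
    and v: "fl_substitution \<epsilon>S L' f' v" and w: "fl_substitution \<epsilon>S (transpose L') v w'"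
    using comp by (auto simp: ic_computed_def)
  have err_v: "norm (matrix_inv L *v f' - v) \<le> t * norm v"
    unfolding t_def by (rule rounded_solve_error[OF inv diag L' v e m])
  have err_w: "norm (matrix_inv (transpose L) *v v - w') \<le> t * norm w'"
    using rounded_solve_error[OF transpose_invertible[OF inv] _ rounded_mat_transpose[OF L'] w e]
      diag m by (simp add: t_def max_nnz_transpose kappa_transpose[OF inv]) (simp add: transpose_def)
  have KT: "spectral_norm (matrix_inv (transpose L)) = K"
    by (simp add: K_def matrix_inv_transpose[OF inv] spectral_norm_transpose)
  have absorb: "norm x \<le> norm y / (1 - t)" if "norm (y - x) \<le> t * norm x" for x y :: "real^'n::{finite,wellorder}"
  proof -
    have "norm x \<le> norm y + norm (y - x)" by (metis norm_triangle_sub norm_minus_commute)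
    with that t1 show ?thesis by (simp add: field_simps)
  qed
  have df: "norm (f' - f) \<le> \<epsilon>S * norm f" using f' by (simp add: rounded_vec_def)
  have nf: "norm f' \<le> (1 + \<epsilon>S) * norm f"
    using norm_triangle_sub[of f' f] df by (simp add: distrib_right)
  define B where "B = K * norm f"
  have B0: "0 \<le> B" using K0 by (simp add: B_def)
  have "norm (matrix_inv L *v f') \<le> K * ((1 + \<epsilon>S) * norm f)"
    using norm_matrix_vector_le[of "matrix_inv L" f'] mult_left_mono[OF nf K0] by (simp add: K_def)
  hence nv: "norm v \<le> (1 + \<epsilon>S) * B / (1 - t)"
    using absorb[OF err_v] t1 divide_right_mono[of _ _ "1 - t"] by (fastforce simp: B_def ac_simps)
  have "norm (matrix_inv (transpose L) *v v) \<le> K * ((1 + \<epsilon>S) * B / (1 - t))"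
    using norm_matrix_vector_le[of "matrix_inv (transpose L)" v] mult_left_mono[OF nv K0]
    by (simp add: KT)
  hence nw: "norm w' \<le> K * ((1 + \<epsilon>S) * B / (1 - t)) / (1 - t)"
    using absorb[OF err_w] t1 divide_right_mono[of _ _ "1 - t"] by fastforce
  have "norm (matrix_inv L *v (f - f')) \<le> \<epsilon>S * B"
    using norm_matrix_vector_le[of "matrix_inv L" "f - f'"] mult_left_mono[OF df K0]
    by (simp add: K_def B_def norm_minus_commute ac_simps)
  moreover have "norm (matrix_inv L *v f - v)
      \<le> norm (matrix_inv L *v (f - f')) + norm (matrix_inv L *v f' - v)"
    using norm_triangle_ineq[of "matrix_inv L *v (f - f')" "matrix_inv L *v f' - v"]
    by (simp add: matrix_vector_mult_diff_distrib)
  ultimately have ev: "norm (matrix_inv L *v f - v) \<le> \<epsilon>S * B + t * ((1 + \<epsilon>S) * B / (1 - t))"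
    using err_v mult_left_mono[OF nv t0] by linarith
  have "ic_exact L f - w' = matrix_inv (transpose L) *v (matrix_inv L *v f - v)
      + (matrix_inv (transpose L) *v v - w')"
    by (simp add: ic_exact_def matrix_vector_mult_diff_distrib)
  hence "norm (ic_exact L f - w') \<le> norm (matrix_inv (transpose L) *v (matrix_inv L *v f - v))
      + norm (matrix_inv (transpose L) *v v - w')"
    by (metis norm_triangle_ineq)
  also have "\<dots> \<le> K * (\<epsilon>S * B + t * ((1 + \<epsilon>S) * B / (1 - t)))
      + t * (K * ((1 + \<epsilon>S) * B / (1 - t)) / (1 - t))"
    using norm_matrix_vector_le[of "matrix_inv (transpose L)" "matrix_inv L *v f - v"]
      mult_left_mono[OF ev K0] err_w mult_left_mono[OF nw t0] unfolding KT by linarith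
  also have "\<dots> = (\<epsilon>S + t * (1 + \<epsilon>S) * (1 / (1 - t) + 1 / (1 - t)\<^sup>2)) * (K * B)"
    by (simp add: algebra_simps power2_eq_square add_divide_distrib)
  also have "\<dots> \<le> (2 * (\<epsilon>R + \<epsilon>S * (m_eps (max_nnz L) \<epsilon>S + 1/2)) * kappa L
         + ic_remainder (max_nnz L) (kappa L) \<epsilon>S \<epsilon>R) * (K * B)"
  proof (rule mult_right_mono)
    \<comment> \<open>Rounding \<open>f\<close> costs \<open>\<epsilon>S\<close>; this is where the summand \<open>1/2\<close> next to \<^const>\<open>m_eps\<close> comes from.\<close>
    have "\<epsilon>S \<le> \<epsilon>S * kappa L" using mult_left_mono[OF \<kappa> e(1)] by simp
    moreover have "2 * (\<epsilon>R + \<epsilon>S * (m_eps (max_nnz L) \<epsilon>S + 1/2)) * kappa L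
         + ic_remainder (max_nnz L) (kappa L) \<epsilon>S \<epsilon>R
         = \<epsilon>S * kappa L + (2 * t + 6 * \<epsilon>S * t + 8 * t\<^sup>2)"
      using \<kappa> by (simp add: ic_remainder_def Let_def t_def[symmetric])
        (simp add: t_def eta_def algebra_simps)
    ultimately show "\<epsilon>S + t * (1 + \<epsilon>S) * (1 / (1 - t) + 1 / (1 - t)\<^sup>2)
        \<le> 2 * (\<epsilon>R + \<epsilon>S * (m_eps (max_nnz L) \<epsilon>S + 1/2)) * kappa L
         + ic_remainder (max_nnz L) (kappa L) \<epsilon>S \<epsilon>R"
      using two_solves_scalar_bound[OF t0 t1 e(1,2)] by linarith
  qed (use K0 B0 in simp)
  finally show ?thesis by (simp add: B_def K_def power2_eq_square mult.assoc)
qed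

theorem theorem5p3:
  shows "\<exists>R :: nat \<Rightarrow> real \<Rightarrow> real \<Rightarrow> real \<Rightarrow> real.
    (\<forall>m \<kappa>. higher_order_on (admissible_roundoffs m \<kappa>) (R m \<kappa>)) \<and>
    (\<forall>(L :: real^'n::{finite,wellorder}^'n::{finite,wellorder}) f \<epsilon>S \<epsilon>R w w'.
       invertible L \<longrightarrow> lower_triangular L \<longrightarrow>
       0 < \<epsilon>S \<longrightarrow> \<epsilon>S \<le> \<epsilon>R \<longrightarrow>
       real (max_nnz L) * \<epsilon>S < 1 \<longrightarrow>
       eta (max_nnz L) \<epsilon>S \<epsilon>R * kappa L < 1/2 \<longrightarrow>
       w = ic_exact L f \<longrightarrow> ic_computed \<epsilon>S \<epsilon>R L f w' \<longrightarrow>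
       norm (w - w') \<le>
         (2 * (\<epsilon>R + \<epsilon>S * (m_eps (max_nnz L) \<epsilon>S + 1/2)) * kappa L
            + R (max_nnz L) (kappa L) \<epsilon>S \<epsilon>R)
         * (spectral_norm (matrix_inv L))\<^sup>2 * norm f)"
  using ic_remainder_higher_order ic_error_bound by (intro exI[of _ ic_remainder]) blast

end
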